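(* Let $Y$ be a metrizable abelian topological group, $X$ be a $Y$-Tychonoff space, and let $H$ be a subgroup of $Y^X$ containing $B_1^{st}(X,Y)$, endowed with the topology of pointwise convergence (induced from the product $Y^X$). Then $H$ is a $\kappa$-Fréchet–Urysohn space.
   Context: $X$ is $Y$-Tychonoff if for every closed $A\subseteq X$, point $y_0\in Y$ and function $f:F\to Y$ defined on a finite set $F\subseteq X\setminus A$, there is a continuous $\bar f:X\to Y$ with $\bar f{\restriction}_F=f$ and $\bar f(A)\subseteq\{y_0\}$. A sequence $\{f_n\}_{n\in\omega}\subseteq Y^X$ stably converges to $f\in Y^X$ if for every $x\in X$ the set $\{n\in\omega: f_n(x)\neq f(x)\}$ is finite. $B_1^{st}(X,Y)\subseteq Y^X$ is the family of all functions $X\to Y$ that are limits of stably convergent sequences of continuous functions from $X$ to $Y$. A space $T$ is $\kappa$-Fréchet–Urysohn if for every open $U\subseteq T$ and every $x\in\overline{U}$ there is a sequence in $U$ converging to $x$. *)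

theory Defs
  imports "HOL-Analysis.Analysis" "HOL-Algebra.Product_Groups"
begin

definition topological_group :: "('a, 'b) monoid_scheme \<Rightarrow> 'a topology \<Rightarrow> bool" where
  "topological_group G T \<longleftrightarrow>
     group G \<and> topspace T = carrier G \<and>
     continuous_map (prod_topology T T) T (\<lambda>(x, y). x \<otimes>\<^bsub>G\<^esub> y) \<and>
     continuous_map T T (\<lambda>x. inv\<^bsub>G\<^esub> x)"

definition Y_Tychonoff :: "'x topology \<Rightarrow> 'y topology \<Rightarrow> bool" where
  "Y_Tychonoff X Y \<longleftrightarrow>
     (\<forall>A y0 F f. closedin X A \<longrightarrow> y0 \<in> topspace Y \<longrightarrow>
        finite F \<longrightarrow> F \<subseteq> topspace X - A \<longrightarrow> f \<in> F \<rightarrow> topspace Y \<longrightarrow>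
        (\<exists>g. continuous_map X Y g \<and> (\<forall>x\<in>F. g x = f x) \<and> g ` A \<subseteq> {y0}))"

definition stably_converges :: "'x set \<Rightarrow> (nat \<Rightarrow> 'x \<Rightarrow> 'y) \<Rightarrow> ('x \<Rightarrow> 'y) \<Rightarrow> bool" where
  "stably_converges S f g \<longleftrightarrow> (\<forall>x\<in>S. finite {n. f n x \<noteq> g x})"

text \<open>
  The set \<open>Y\<^sup>X\<close> is rendered as the extensional function space
  \<open>topspace X \<rightarrow>\<^sub>E topspace Y\<close>, which is also the carrier of
  \<^const>\<open>product_group\<close> and of \<^const>\<open>product_topology\<close>.
  The approximating functions need not be extensional: their values outside
  \<open>topspace X\<close> affect neither continuity nor stable convergence.
\<close>

definition B1st :: "'x topology \<Rightarrow> 'y topology \<Rightarrow> ('x \<Rightarrow> 'y) set" where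
  "B1st X Y =
     {f \<in> topspace X \<rightarrow>\<^sub>E topspace Y.
        \<exists>g. (\<forall>n. continuous_map X Y (g n)) \<and> stably_converges (topspace X) g f}"

definition kappa_Frechet_Urysohn :: "'a topology \<Rightarrow> bool" where
  "kappa_Frechet_Urysohn T \<longleftrightarrow>
     (\<forall>U x. openin T U \<longrightarrow> x \<in> T closure_of U \<longrightarrow>
        (\<exists>s. (\<forall>n. s n \<in> U) \<and> limitin T s x sequentially))"

end

theory Submission
  imports Defs
begin

text \<open>
  Let \<open>h\<close> lie in the closure of \<open>U\<close>. Choose inductively \<open>u\<^sub>n \<in> U\<close> and finite sets
  \<open>F\<^sub>n \<subseteq> F\<^sub>n\<^sub>+\<^sub>1\<close> such that \<open>u\<^sub>n\<close> is \<open>1/(n+1)\<close>-close to \<open>h\<close> on \<open>F\<^sub>n\<close>, and every element of \<open>H\<close> that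
  agrees with \<open>u\<^sub>n\<close> on \<open>F\<^sub>n\<^sub>+\<^sub>1\<close> is in \<open>U\<close>. It remains to find \<open>b\<^sub>n \<in> B\<^sub>1\<^sup>s\<^sup>t\<close> that agree with
  \<open>h\<^sup>-\<^sup>1 u\<^sub>n\<close> on \<open>F\<^sub>n\<^sub>+\<^sub>1\<close> and tend to the unit pointwise, for then \<open>h b\<^sub>n\<close> is the required sequence.
  For this, build a countable family of continuous functions \<open>f\<^sub>k\<^sub>,\<^sub>n\<close> which agree with
  \<open>h\<^sup>-\<^sup>1 u\<^sub>n\<close> on \<open>F\<^sub>n\<^sub>+\<^sub>1\<close> and are trivial at points that the earlier members of
  the family distinguish from \<open>F\<^sub>n\<^sub>+\<^sub>1\<close>. As \<open>k\<close> grows, \<open>f\<^sub>k\<^sub>,\<^sub>n\<close> converges stably to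
  a function \<open>b\<^sub>n\<close>. At a point that the whole family does not distinguish from some
  \<open>d \<in> \<Union>\<^sub>n F\<^sub>n\<close>, the value of \<open>b\<^sub>n\<close> is \<open>h(d)\<^sup>-\<^sup>1 u\<^sub>n(d)\<close> for large \<open>n\<close>; at
  all other points \<open>b\<^sub>n\<close> is trivial.
\<close>

text \<open>When the \<open>F n\<close> increase, a point \<open>d\<close> of their union lies in
  almost all of them. The third conclusion then makes the sequence \<open>b n y\<close> either
  constantly \<open>e\<close> or eventually equal to \<open>g n d\<close>, with one \<open>d\<close>
  for all \<open>n\<close>; this reduces pointwise convergence of \<open>b\<close> to convergence of
  \<open>g\<close> on the union.\<close>

lemma B1st_interpolation:
  fixes F :: "nat \<Rightarrow> 'x set" and g :: "nat \<Rightarrow> 'x \<Rightarrow> 'y"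
  assumes met: "metrizable_space Y" and tych: "Y_Tychonoff X Y" and e: "e \<in> topspace Y"
    and fin: "\<And>n. finite (F n)" and sub: "\<And>n. F n \<subseteq> topspace X"
    and g: "\<And>n x. x \<in> F n \<Longrightarrow> g n x \<in> topspace Y"
  obtains b where "\<And>n. b n \<in> B1st X Y" "\<And>n x. x \<in> F n \<Longrightarrow> b n x = g n x"
    "\<And>y. y \<in> topspace X \<Longrightarrow>
       (\<forall>n. b n y = e) \<or> (\<exists>d\<in>(\<Union>n. F n). \<forall>n. d \<in> F n \<longrightarrow> b n y = g n d)"
proof -
  obtain M d where Md: "Metric_space M d" and Y: "Y = Metric_space.mtopology M d"
    using met unfolding metrizable_space_def by blast
  interpret Metric_space M d by (rule Md)
  have tY: "topspace Y = M" by (simp add: Y)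
  \<comment> \<open>Bounding both \<open>j\<close> and \<open>m\<close> by \<open>k\<close> leaves
    finitely many conditions, so \<open>W f n k\<close> is open. The growing range and shrinking
    tolerance expel every point that some \<open>f j m\<close> separates from each point of
    \<open>F n\<close>.\<close>
  define W :: "(nat \<Rightarrow> nat \<Rightarrow> 'x \<Rightarrow> 'y) \<Rightarrow> nat \<Rightarrow> nat \<Rightarrow> 'x set" where
    "W f n k = (\<Union>x\<in>F n. {y \<in> topspace X. \<forall>j<k. \<forall>m<k. d (f j m x) (f j m y) < 1 / (1 + real k)})"
    for f n k
  define P where "P f k r \<longleftrightarrow>
     (\<forall>n. continuous_map X Y (r n) \<and> (\<forall>x\<in>F n. r n x = g n x) \<and>
          (\<forall>y\<in>topspace X - W f n k. r n y = e))" for f k r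
  \<comment> \<open>Recursion on the stage \<open>k\<close>, treating all \<open>n\<close> at once:
    \<open>W f n k\<close> involves only the stages below \<open>k\<close>.\<close>
  have "\<exists>f. \<forall>k. P f k (f k)"
  proof (rule dependent_wellorder_choice)
    fix r :: "nat \<Rightarrow> 'x \<Rightarrow> 'y" and f f' :: "nat \<Rightarrow> nat \<Rightarrow> 'x \<Rightarrow> 'y" and k :: nat
    assume "\<And>j. j < k \<Longrightarrow> f j = f' j"
    then have "W f n k = W f' n k" for n by (simp add: W_def)
    then show "P f k r = P f' k r" by (simp add: P_def)
  next
    fix k :: nat and f
    assume prev: "\<And>j. j < k \<Longrightarrow> P f j (f j)"
    then have cont: "continuous_map X Y (f j m)" if "j < k" for j m
      using that by (simp add: P_def)
    have fM: "f j m x \<in> M" if "j < k" "x \<in> topspace X" for j m x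
      using continuous_map_image_subset_topspace[OF cont[OF that(1)]] that(2) tY by blast
    have "\<exists>r. continuous_map X Y r \<and> (\<forall>x\<in>F n. r x = g n x) \<and> r ` (topspace X - W f n k) \<subseteq> {e}" for n
    proof -
      have "openin X {y \<in> topspace X. \<forall>j<k. \<forall>m<k. d (f j m x) (f j m y) < 1 / (1 + real k)}"
        if x: "x \<in> F n" for x
      proof -
        have "openin X {y \<in> topspace X. f j m y \<in> mball (f j m x) (1 / (1 + real k))}"
          if "j < k" for j m
          by (rule openin_continuous_map_preimage[OF cont[OF that]]) (simp add: Y)
        then have "openin X (topspace X \<inter> (\<Inter>(j,m)\<in>{..<k}\<times>{..<k}.
            {y \<in> topspace X. f j m y \<in> mball (f j m x) (1 / (1 + real k))}))"
          by (intro openin_Int_Inter) auto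
        also have "topspace X \<inter> (\<Inter>(j,m)\<in>{..<k}\<times>{..<k}.
            {y \<in> topspace X. f j m y \<in> mball (f j m x) (1 / (1 + real k))})
          = {y \<in> topspace X. \<forall>j<k. \<forall>m<k. d (f j m x) (f j m y) < 1 / (1 + real k)}"
          using fM x sub[of n] by (auto simp: in_mball subset_iff)
        finally show ?thesis .
      qed
      then have "openin X (W f n k)" unfolding W_def by blast
      then have "closedin X (topspace X - W f n k)" by blast
      moreover have "x \<in> W f n k" if x: "x \<in> F n" for x
      proof -
        have "x \<in> topspace X" using x sub by blast
        with fM have "x \<in> topspace X \<and> (\<forall>j<k. \<forall>m<k. d (f j m x) (f j m x) < 1 / (1 + real k))"
          by simp
        with x show ?thesis unfolding W_def by blast
      qed
      then have "F n \<subseteq> topspace X - (topspace X - W f n k)" using sub[of n] by blast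
      ultimately show ?thesis
        using tych[unfolded Y_Tychonoff_def, rule_format, of "topspace X - W f n k" e "F n" "g n"] e fin[of n] g
        by blast
    qed
    then obtain r where "\<forall>n. continuous_map X Y (r n) \<and> (\<forall>x\<in>F n. r n x = g n x) \<and>
        r n ` (topspace X - W f n k) \<subseteq> {e}" by metis
    then show "\<exists>r. P f k r" unfolding P_def by blast
  qed
  then obtain f where f: "\<And>k. P f k (f k)" by blast
  have cont: "continuous_map X Y (f k n)" and fg: "x \<in> F n \<Longrightarrow> f k n x = g n x"
    and fe: "y \<in> topspace X \<Longrightarrow> y \<notin> W f n k \<Longrightarrow> f k n y = e" for k n x y
    using f[of k] by (auto simp: P_def)
  have fM: "f k n x \<in> M" if "x \<in> topspace X" for k n x
    using continuous_map_image_subset_topspace[OF cont] that tY by blast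
  \<comment> \<open>The relation ranges over all \<open>n\<close>, not just those with
    \<open>x \<in> F n\<close>, so that the same \<open>x\<close> serves every
    \<open>b n\<close>.\<close>
  define E where "E x y \<longleftrightarrow> (\<forall>k n. f k n x = f k n y)" for x y
  have far: "\<exists>K. \<forall>k\<ge>K. y \<notin> W f n k"
    if y: "y \<in> topspace X" and nE: "\<And>x. x \<in> F n \<Longrightarrow> \<not> E x y" for n y
  proof -
    have "\<forall>\<^sub>F k in sequentially. \<not> (\<forall>j<k. \<forall>m<k. d (f j m x) (f j m y) < 1 / (1 + real k))"
      if x: "x \<in> F n" for x
    proof -
      obtain j m where jm: "f j m x \<noteq> f j m y" using nE[OF x] by (auto simp: E_def)
      then have pos: "0 < d (f j m x) (f j m y)"
        using fM y x sub[of n] by (metis mdist_pos_less subsetD)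
      have "(\<lambda>k. 1 / (1 + real k)) \<longlonglongrightarrow> 0" using LIMSEQ_inverse_real_of_nat by (simp add: inverse_eq_divide)
      then have "\<forall>\<^sub>F k in sequentially. 1 / (1 + real k) < d (f j m x) (f j m y)"
        using pos by (rule order_tendstoD(2))
      moreover have "\<forall>\<^sub>F k in sequentially. j < k" "\<forall>\<^sub>F k in sequentially. m < k"
        by (rule eventually_gt_at_top)+
      ultimately show ?thesis
        by eventually_elim (meson less_asym)
    \<comment> \<open>One separating pair \<open>j\<close>, \<open>m\<close> suffices as soon as
      \<open>k\<close> exceeds both and the tolerance drops below the distance it produces.
      Finiteness of \<open>F n\<close> now gives a common bound.\<close>
    qed
    then have "\<forall>\<^sub>F k in sequentially. \<forall>x\<in>F n.
        \<not> (\<forall>j<k. \<forall>m<k. d (f j m x) (f j m y) < 1 / (1 + real k))"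
      using fin[of n] by (simp add: eventually_ball_finite)
    then have "\<forall>\<^sub>F k in sequentially. y \<notin> W f n k"
      by eventually_elim (unfold W_def, blast)
    then show ?thesis by (simp add: eventually_sequentially)
  qed
  \<comment> \<open>Stage \<open>0\<close> is an arbitrary choice: if \<open>E x y\<close> with
    \<open>x \<in> F n\<close>, then \<open>f k n y = f k n x = g n x\<close> for every
    \<open>k\<close>.\<close>
  define b where "b n = (\<lambda>y\<in>topspace X. if \<exists>x\<in>F n. E x y then f 0 n y else e)" for n
  have bE: "b n y = g n x" if "x \<in> F n" "E x y" "y \<in> topspace X" for n x y
    using that fg[of x n 0] by (auto simp: b_def E_def)
  show thesis
  proof
    fix n
    have "b n \<in> topspace X \<rightarrow>\<^sub>E topspace Y"
      using fM e by (auto simp: b_def tY)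
    moreover have "stably_converges (topspace X) (\<lambda>k. f k n) (b n)"
      unfolding stably_converges_def
    proof
      fix y assume y: "y \<in> topspace X"
      show "finite {k. f k n y \<noteq> b n y}"
      proof (cases "\<exists>x\<in>F n. E x y")
        case True
        then obtain x where x: "x \<in> F n" "E x y" by blast
        then have "f k n y = b n y" for k
          using bE[OF x y] fg[OF x(1), of k] by (simp add: E_def)
        then show ?thesis by simp
      next
        case False
        then obtain K where "\<And>k. k \<ge> K \<Longrightarrow> y \<notin> W f n k" using far[OF y] by blast
        then have "f k n y = b n y" if "k \<ge> K" for k
          using that False y fe by (simp add: b_def)
        then have "{k. f k n y \<noteq> b n y} \<subseteq> {..<K}" by (force simp: not_le[symmetric])
        then show ?thesis by (rule finite_subset) simp
      qed
    qed
    ultimately show "b n \<in> B1st X Y"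
      using cont unfolding B1st_def by (intro CollectI conjI exI[of _ "\<lambda>k. f k n"]) simp_all
  next
    fix n x assume "x \<in> F n"
    then show "b n x = g n x" using sub[of n] by (intro bE) (auto simp: E_def)
  next
    fix y assume y: "y \<in> topspace X"
    show "(\<forall>n. b n y = e) \<or> (\<exists>d\<in>(\<Union>n. F n). \<forall>n. d \<in> F n \<longrightarrow> b n y = g n d)"
    proof (cases "\<exists>x\<in>(\<Union>n. F n). E x y")
      case True
      then show ?thesis using bE y by blast
    next
      case False
      then show ?thesis using y by (auto simp: b_def)
    qed
  qed
qed

theorem theorem5p14:
  fixes G :: "('y, 'b) monoid_scheme"
    and Y :: "'y topology"
    and X :: "'x topology"
    and H :: "('x \<Rightarrow> 'y) set"
  assumes "comm_group G"
    and "topological_group G Y"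
    and "metrizable_space Y"
    and "Y_Tychonoff X Y"
    and "subgroup H (product_group (topspace X) (\<lambda>_. G))"
    and "B1st X Y \<subseteq> H"
  shows "kappa_Frechet_Urysohn (subtopology (product_topology (\<lambda>_. Y) (topspace X)) H)"
  unfolding kappa_Frechet_Urysohn_def
proof (intro allI impI)
  fix U h
  let ?S = "topspace X"
  let ?P = "product_topology (\<lambda>_. Y) ?S"
  assume U: "openin (subtopology ?P H) U" and h: "h \<in> subtopology ?P H closure_of U"
  interpret group G using assms(2) by (simp add: topological_group_def)
  have tY: "topspace Y = carrier G"
    and mult: "continuous_map (prod_topology Y Y) Y (\<lambda>(x, y). x \<otimes>\<^bsub>G\<^esub> y)"
    using assms(2) by (auto simp: topological_group_def)
  obtain M d where Md: "Metric_space M d" and Y: "Y = Metric_space.mtopology M d"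
    using assms(3) unfolding metrizable_space_def by blast
  interpret Metric_space M d by (rule Md)
  have tM: "topspace Y = M" by (simp add: Y)
  have HP: "H \<subseteq> topspace ?P"
    using subgroup.subset[OF assms(5)] tY by simp
  have UH: "U \<subseteq> H" using openin_subset[OF U] by simp
  obtain V where V: "openin ?P V" "U = V \<inter> H" using U by (auto simp: openin_subtopology)
  have hH: "h \<in> H" using h by (simp add: in_closure_of)
  then have hM: "h x \<in> carrier G" if "x \<in> ?S" for x
    using HP that tY by (auto simp: PiE_iff)
  have step: "\<exists>u E. u \<in> U \<and> (\<forall>x\<in>F. d (h x) (u x) < 1 / (1 + real n)) \<and> finite E \<and> E \<subseteq> ?S \<and>
       (\<forall>v\<in>H. (\<forall>x\<in>E. v x = u x) \<longrightarrow> v \<in> U)" if F: "finite F" "F \<subseteq> ?S" for F n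
  proof -
    \<comment> \<open>A basic neighbourhood of \<open>h\<close>; it meets \<open>U\<close> because
      \<open>h\<close> is in the closure, and \<open>u\<close> is taken there.\<close>
    let ?B = "\<lambda>x. if x \<in> F then mball (h x) (1 / (1 + real n)) else topspace Y"
    have "openin ?P (PiE ?S ?B)"
      by (rule openin_PiE_gen[THEN iffD2]) (use F in \<open>auto simp: Y intro: rev_finite_subset\<close>)
    then have "openin (subtopology ?P H) (PiE ?S ?B \<inter> H)" by (auto simp: openin_subtopology)
    moreover have "h \<in> PiE ?S ?B \<inter> H"
      using hH HP tM F(2) by (auto simp: PiE_iff subset_iff)
    ultimately obtain u where u: "u \<in> U" "u \<in> PiE ?S ?B \<inter> H"
      using h unfolding in_closure_of by blast
    then have uV: "u \<in> V" using V(2) by blast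
    \<comment> \<open>The coordinates restricted by this box around \<open>u\<close> form the
      required finite set \<open>E\<close>.\<close>
    obtain C where C: "finite {i \<in> ?S. C i \<noteq> topspace Y}" "u \<in> PiE ?S C" "PiE ?S C \<subseteq> V"
      using V(1)[unfolded openin_product_topology_alt, rule_format, OF uV] by blast
    have "v \<in> U" if v: "v \<in> H" "\<forall>x\<in>{i \<in> ?S. C i \<noteq> topspace Y}. v x = u x" for v
    proof -
      have "v \<in> PiE ?S C"
      proof
        fix x assume "x \<in> ?S"
        then show "v x \<in> C x"
          using v C(2) HP by (cases "C x = topspace Y") (auto simp: PiE_iff subset_iff)
      next
        fix x assume "x \<notin> ?S"
        then show "v x = undefined" using v HP by (auto simp: PiE_iff extensional_def subset_iff)
      qed
      then show ?thesis using C V v by blast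
    qed
    moreover have "d (h x) (u x) < 1 / (1 + real n)" if "x \<in> F" for x
      using PiE_mem[OF IntD1[OF u(2)], of x] that F(2) by (auto simp: in_mball)
    ultimately show ?thesis using u(1) C(1)
      by (intro exI[of _ u] exI[of _ "{i \<in> ?S. C i \<noteq> topspace Y}"]) auto
  qed
  then obtain u E where uE: "\<And>F n. finite F \<Longrightarrow> F \<subseteq> ?S \<Longrightarrow>
       u F n \<in> U \<and> (\<forall>x\<in>F. d (h x) (u F n x) < 1 / (1 + real n)) \<and> finite (E F n) \<and> E F n \<subseteq> ?S \<and>
       (\<forall>v\<in>H. (\<forall>x\<in>E F n. v x = u F n x) \<longrightarrow> v \<in> U)" by metis
  \<comment> \<open>\<open>w n\<close> below is close to \<open>h\<close> only on
    \<open>F n\<close>, while membership in \<open>U\<close> is decided on the larger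
    \<open>F (Suc n)\<close>. Hence the interpolation is done on \<open>F (Suc n)\<close>.\<close>
  define F where "F = rec_nat {} (\<lambda>n F. F \<union> E F n)"
  have F0: "F 0 = {}" and FS: "F (Suc n) = F n \<union> E (F n) n" for n by (simp_all add: F_def)
  have Ffin: "finite (F n) \<and> F n \<subseteq> ?S" for n
    by (induction n) (use uE in \<open>auto simp: F0 FS\<close>)
  have Fmono: "F m \<subseteq> F n" if "m \<le> n" for m n
    using that by (rule lift_Suc_mono_le[rotated]) (simp add: FS)
  define w where "w n = u (F n) n" for n
  have wU: "w n \<in> U" and wd: "x \<in> F n \<Longrightarrow> d (h x) (w n x) < 1 / (1 + real n)"
    and wE: "v \<in> H \<Longrightarrow> (\<And>x. x \<in> F (Suc n) \<Longrightarrow> v x = w n x) \<Longrightarrow> v \<in> U" for n x v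
    using uE[of "F n" n] Ffin[of n] by (auto simp: w_def FS)
  have wG: "w n x \<in> carrier G" if "x \<in> ?S" for n x
    using wU UH HP that tY by (fastforce simp: PiE_iff)
  obtain b where b: "\<And>n. b n \<in> B1st X Y"
    and bF: "\<And>n x. x \<in> F (Suc n) \<Longrightarrow> b n x = inv\<^bsub>G\<^esub> h x \<otimes>\<^bsub>G\<^esub> w n x"
    and blim: "\<And>y. y \<in> ?S \<Longrightarrow> (\<forall>n. b n y = \<one>\<^bsub>G\<^esub>) \<or>
       (\<exists>d\<in>(\<Union>n. F (Suc n)). \<forall>n. d \<in> F (Suc n) \<longrightarrow> b n y = inv\<^bsub>G\<^esub> h d \<otimes>\<^bsub>G\<^esub> w n d)"
  proof (rule B1st_interpolation[OF assms(3,4), of "\<one>\<^bsub>G\<^esub>" "\<lambda>n. F (Suc n)"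
        "\<lambda>n x. inv\<^bsub>G\<^esub> h x \<otimes>\<^bsub>G\<^esub> w n x"])
    show "inv\<^bsub>G\<^esub> h x \<otimes>\<^bsub>G\<^esub> w n x \<in> topspace Y" if "x \<in> F (Suc n)" for n x
      using that Ffin[of "Suc n"] hM wG tY by blast
  qed (use Ffin tY in auto)
  have bG: "b n y \<in> carrier G" if "y \<in> ?S" for n y
    using b[of n] that tY by (auto simp: B1st_def)
  \<comment> \<open>On \<open>F (Suc n)\<close> the factor \<open>h x\<close> cancels its inverse in
    \<open>b n x\<close>, leaving \<open>w n x\<close>. The restriction to \<open>topspace X\<close>
    matches multiplication in the product group.\<close>
  define s where "s n = (\<lambda>x\<in>?S. h x \<otimes>\<^bsub>G\<^esub> b n x)" for n
  have sH: "s n \<in> H" for n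
    using subgroup.m_closed[OF assms(5) hH, of "b n"] b assms(6) by (auto simp: s_def)
  have sU: "s n \<in> U" for n
  proof (rule wE[OF sH])
    fix x assume x: "x \<in> F (Suc n)"
    then have "x \<in> ?S" using Ffin by blast
    then show "s n x = w n x"
      using hM[of x] wG[of x n] by (simp add: s_def bF[OF x] m_assoc[symmetric])
  qed
  have lmult: "limitin Y (\<lambda>n. c \<otimes>\<^bsub>G\<^esub> a n) (c \<otimes>\<^bsub>G\<^esub> l) sequentially"
    if "c \<in> carrier G" "limitin Y a l sequentially" for c a l
  proof -
    have "continuous_map Y Y (\<lambda>x. c \<otimes>\<^bsub>G\<^esub> x)"
      using continuous_map_compose[OF _ mult, of Y "\<lambda>x. (c, x)"] that(1) tY
      by (simp add: o_def continuous_map_pairwise)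
    from continuous_map_limit[OF this that(2)] show ?thesis by (simp add: o_def)
  qed
  have "limitin Y (\<lambda>n. s n y) (h y) sequentially" if y: "y \<in> ?S" for y
  proof -
    have "limitin Y (\<lambda>n. b n y) \<one>\<^bsub>G\<^esub> sequentially"
      using blim[OF y]
    proof
      assume "\<forall>n. b n y = \<one>\<^bsub>G\<^esub>"
      then show ?thesis by (simp add: tY)
    next
      assume "\<exists>d\<in>(\<Union>n. F (Suc n)). \<forall>n. d \<in> F (Suc n) \<longrightarrow> b n y = inv\<^bsub>G\<^esub> h d \<otimes>\<^bsub>G\<^esub> w n d"
      then obtain x N where x: "x \<in> F (Suc N)"
        and eq: "\<And>n. x \<in> F (Suc n) \<Longrightarrow> b n y = inv\<^bsub>G\<^esub> h x \<otimes>\<^bsub>G\<^esub> w n x" by blast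
      have xS: "x \<in> ?S" using x Ffin by blast
      \<comment> \<open>From \<open>Suc N\<close> on, \<open>x\<close> lies in \<open>F n\<close>
        itself, where the distance estimate for \<open>w n\<close> holds.\<close>
      have ev: "x \<in> F n" if "n \<ge> Suc N" for n using Fmono[OF that] x by blast
      have "limitin Y (\<lambda>n. w n x) (h x) sequentially"
        unfolding Y limit_metric_sequentially
      proof (intro conjI allI impI)
        show "h x \<in> M" using hM xS tY tM by simp
        fix \<epsilon> :: real assume "\<epsilon> > 0"
        moreover have "(\<lambda>n. 1 / (1 + real n)) \<longlonglongrightarrow> 0" using LIMSEQ_inverse_real_of_nat by (simp add: inverse_eq_divide)
        ultimately have "\<forall>\<^sub>F n in sequentially. 1 / (1 + real n) < \<epsilon>"
          by (auto dest: order_tendstoD(2))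
        then obtain K where K: "\<And>n. n \<ge> K \<Longrightarrow> 1 / (1 + real n) < \<epsilon>"
          by (auto simp: eventually_sequentially)
        have "w n x \<in> M \<and> d (w n x) (h x) < \<epsilon>" if "n \<ge> max K (Suc N)" for n
          using that K[of n] wd[OF ev[of n]] wG[OF xS] tY tM commute[of "h x"] by force
        then show "\<exists>K. \<forall>n\<ge>K. w n x \<in> M \<and> d (w n x) (h x) < \<epsilon>" by blast
      qed
      from lmult[OF _ this, of "inv\<^bsub>G\<^esub> h x"]
      have "limitin Y (\<lambda>n. inv\<^bsub>G\<^esub> h x \<otimes>\<^bsub>G\<^esub> w n x) \<one>\<^bsub>G\<^esub> sequentially" using hM xS by simp
      moreover have "\<forall>\<^sub>F n in sequentially. inv\<^bsub>G\<^esub> h x \<otimes>\<^bsub>G\<^esub> w n x = b n y"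
        unfolding eventually_sequentially using ev eq by (metis le_SucI)
      ultimately show ?thesis by (rule limitin_transform_eventually[rotated])
    qed
    from lmult[OF hM[OF y] this] show ?thesis using y hM by (simp add: s_def)
  qed
  moreover have "s n \<in> ?S \<rightarrow>\<^sub>E topspace Y" for n using sH HP by auto
  ultimately have "limitin ?P s h sequentially"
    using hH HP by (auto simp: limitin_componentwise PiE_iff)
  then have "limitin (subtopology ?P H) s h sequentially"
    using hH sH by (simp add: limitin_subtopology)
  with sU show "\<exists>s. (\<forall>n. s n \<in> U) \<and> limitin (subtopology ?P H) s h sequentially" by blast
qed

end
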